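(* Let $L$ be a complete lattice with unary operations $\neg,\Box,\Diamond$ such that $\neg$ is dually self-adjoint with $\neg1=0$, $\Box$ is completely multiplicative, $\Diamond$ is completely additive, and $\Diamond\neg a\leq\neg\Box a$ for all $a\in L$. Define $X=\{(a,b)\mid a,b\in L,\ \neg a\leq b\}$, writing $x_0=a$, $x_1=b$ for $x=(a,b)$; $x\vartriangleleft y$ iff $y_0\not\leq x_1$; $xRy$ iff for all $a\in L$ both ($x_0\leq\Box a\Rightarrow y_0\leq a$) and ($\Diamond a\leq x_1\Rightarrow a\leq y_1$); and $Q=R$. Then: (1) $\mathcal{F}=(X,\vartriangleleft,R,Q)$ is a unified, additive modal frame with $\vartriangleleft$ pseudo-symmetric; (2) $(L,\neg,\Box,\Diamond)$ is isomorphic to $(\mathfrak{L}(X,\vartriangleleft),\neg_\vartriangleleft,\Box_R,\Diamond_Q)$; (3) if $a\wedge\neg a=0$ for all $a\in L$, then $\vartriangleleft$ is pseudo-reflexive; (4) if $\neg\Diamond a\leq\Box\neg a$ for all $a\in L$, then $\mathcal{F}$ is negative.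
   Context: Dually self-adjoint: $a\leq\neg b$ implies $b\leq\neg a$. Completely multiplicative/additive: $\Box$ preserves all meets, $\Diamond$ preserves all joins. A modal frame is $(X,\vartriangleleft,R,Q)$ with $X$ nonempty and binary relations such that for all $x,y,z$: if $xRy$ and $z\vartriangleleft y$, then there is $x'\vartriangleleft x$ such that for all $x''$ with $x'\vartriangleleft x''$ there is $y''$ with $x''Ry''$ and $z\vartriangleleft y''$. It is unified if $R=Q$; additive if for all $x,y,z$: if $xQy$ and $y\vartriangleleft z$ then there is $x'$ with $x\vartriangleleft x'$ such that for all $x''\vartriangleleft x'$ there is $y''$ with $x''Qy''$ and $y''\vartriangleleft z$; negative if for all $x,y,z$: if $xRy$ and $z\vartriangleleft y$ then there is $x'\vartriangleleft x$ such that for all $x''\vartriangleleft x'$ there is $y''$ with $x''Qy''$ and $y''\vartriangleleft z$. Say $z$ pre-refines $x$ if every $w\vartriangleleft z$ satisfies $w\vartriangleleft x$; $x$ is non-absurd if some $y\vartriangleleft x$. $\vartriangleleft$ is pseudo-reflexive if every non-absurd $x$ has some $z\vartriangleleft x$ that pre-refines $x$; pseudo-symmetric if for all $x$ and $y\vartriangleleft x$ there is $z\vartriangleleft y$ that pre-refines $x$. ($u\vartriangleright v$ means $v\vartriangleleft u$.) $c_\vartriangleleft(A)=\{x\mid \forall y\vartriangleleft x\ \exists z\vartriangleright y: z\in A\}$; $\mathfrak{L}(X,\vartriangleleft)$ is the complete lattice of its fixpoints (meet = intersection, join = $c_\vartriangleleft$ of union). $\neg_\vartriangleleft A=\{x\mid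 \forall y\vartriangleleft x,\ y\notin A\}$; $\Box_RA=\{x\mid \forall y(xRy\Rightarrow y\in A)\}$; $\Diamond_QA=\{x\mid \forall x'\vartriangleleft x\ \exists y'\,(x'Qy')\ \exists y\vartriangleright y': y\in A\}$. *)

theory Defs
  imports Main
begin

section \<open>Operations on a complete lattice\<close>

definition dually_self_adjoint :: "('a::complete_lattice \<Rightarrow> 'a) \<Rightarrow> bool" where
  "dually_self_adjoint neg \<longleftrightarrow> (\<forall>a b. a \<le> neg b \<longrightarrow> b \<le> neg a)"

text \<open>All meets and joins are meant, including the empty ones.\<close>

definition completely_multiplicative :: "('a::complete_lattice \<Rightarrow> 'a) \<Rightarrow> bool" where
  "completely_multiplicative box \<longleftrightarrow> (\<forall>S. box (Inf S) = (INF a\<in>S. box a))"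

definition completely_additive :: "('a::complete_lattice \<Rightarrow> 'a) \<Rightarrow> bool" where
  "completely_additive dia \<longleftrightarrow> (\<forall>S. dia (Sup S) = (SUP a\<in>S. dia a))"


section \<open>Modal frames\<close>

text \<open>Throughout, \<open>T\<close> stands for the relation written as a left-pointing triangle:
  \<open>(y, x) \<in> T\<close> means that \<open>y\<close> is to the left of the triangle and \<open>x\<close> to the right.
  Points range over the carrier \<open>X\<close>.\<close>

definition modal_frame :: "'x set \<Rightarrow> 'x rel \<Rightarrow> 'x rel \<Rightarrow> 'x rel \<Rightarrow> bool" where
  "modal_frame X T R Q \<longleftrightarrow>
     X \<noteq> {} \<and> T \<subseteq> X \<times> X \<and> R \<subseteq> X \<times> X \<and> Q \<subseteq> X \<times> X \<and>
     (\<forall>x\<in>X. \<forall>y\<in>X. \<forall>z\<in>X. (x, y) \<in> R \<and> (z, y) \<in> T \<longrightarrow>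
        (\<exists>x'\<in>X. (x', x) \<in> T \<and>
           (\<forall>x''\<in>X. (x', x'') \<in> T \<longrightarrow>
              (\<exists>y''\<in>X. (x'', y'') \<in> R \<and> (z, y'') \<in> T))))"

definition unified_frame :: "'x set \<Rightarrow> 'x rel \<Rightarrow> 'x rel \<Rightarrow> 'x rel \<Rightarrow> bool" where
  "unified_frame X T R Q \<longleftrightarrow> R = Q"

definition additive_frame :: "'x set \<Rightarrow> 'x rel \<Rightarrow> 'x rel \<Rightarrow> 'x rel \<Rightarrow> bool" where
  "additive_frame X T R Q \<longleftrightarrow>
     (\<forall>x\<in>X. \<forall>y\<in>X. \<forall>z\<in>X. (x, y) \<in> Q \<and> (y, z) \<in> T \<longrightarrow>
        (\<exists>x'\<in>X. (x, x') \<in> T \<and>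
           (\<forall>x''\<in>X. (x'', x') \<in> T \<longrightarrow>
              (\<exists>y''\<in>X. (x'', y'') \<in> Q \<and> (y'', z) \<in> T))))"

definition negative_frame :: "'x set \<Rightarrow> 'x rel \<Rightarrow> 'x rel \<Rightarrow> 'x rel \<Rightarrow> bool" where
  "negative_frame X T R Q \<longleftrightarrow>
     (\<forall>x\<in>X. \<forall>y\<in>X. \<forall>z\<in>X. (x, y) \<in> R \<and> (z, y) \<in> T \<longrightarrow>
        (\<exists>x'\<in>X. (x', x) \<in> T \<and>
           (\<forall>x''\<in>X. (x'', x') \<in> T \<longrightarrow>
              (\<exists>y''\<in>X. (x'', y'') \<in> Q \<and> (y'', z) \<in> T))))"

definition pre_refines :: "'x set \<Rightarrow> 'x rel \<Rightarrow> 'x \<Rightarrow> 'x \<Rightarrow> bool" where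
  "pre_refines X T z x \<longleftrightarrow> (\<forall>w\<in>X. (w, z) \<in> T \<longrightarrow> (w, x) \<in> T)"

definition non_absurd :: "'x set \<Rightarrow> 'x rel \<Rightarrow> 'x \<Rightarrow> bool" where
  "non_absurd X T x \<longleftrightarrow> (\<exists>y\<in>X. (y, x) \<in> T)"

definition pseudo_reflexive :: "'x set \<Rightarrow> 'x rel \<Rightarrow> bool" where
  "pseudo_reflexive X T \<longleftrightarrow>
     (\<forall>x\<in>X. non_absurd X T x \<longrightarrow> (\<exists>z\<in>X. (z, x) \<in> T \<and> pre_refines X T z x))"

definition pseudo_symmetric :: "'x set \<Rightarrow> 'x rel \<Rightarrow> bool" where
  "pseudo_symmetric X T \<longleftrightarrow>
     (\<forall>x\<in>X. \<forall>y\<in>X. (y, x) \<in> T \<longrightarrow> (\<exists>z\<in>X. (z, y) \<in> T \<and> pre_refines X T z x))"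


section \<open>The lattice of fixpoints with its operations\<close>

definition frame_closure :: "'x set \<Rightarrow> 'x rel \<Rightarrow> 'x set \<Rightarrow> 'x set" where
  "frame_closure X T A = {x\<in>X. \<forall>y\<in>X. (y, x) \<in> T \<longrightarrow> (\<exists>z\<in>X. (y, z) \<in> T \<and> z \<in> A)}"

definition fixpoints :: "'x set \<Rightarrow> 'x rel \<Rightarrow> 'x set set" where
  "fixpoints X T = {A. A \<subseteq> X \<and> frame_closure X T A = A}"

text \<open>The intersection with \<open>X\<close> makes the empty meet equal to the top element \<open>X\<close>.\<close>

definition fix_Meet :: "'x set \<Rightarrow> 'x set set \<Rightarrow> 'x set" where
  "fix_Meet X \<A> = X \<inter> \<Inter>\<A>"

definition fix_Join :: "'x set \<Rightarrow> 'x rel \<Rightarrow> 'x set set \<Rightarrow> 'x set" where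
  "fix_Join X T \<A> = frame_closure X T (\<Union>\<A>)"

definition frame_neg :: "'x set \<Rightarrow> 'x rel \<Rightarrow> 'x set \<Rightarrow> 'x set" where
  "frame_neg X T A = {x\<in>X. \<forall>y\<in>X. (y, x) \<in> T \<longrightarrow> y \<notin> A}"

definition frame_box :: "'x set \<Rightarrow> 'x rel \<Rightarrow> 'x set \<Rightarrow> 'x set" where
  "frame_box X R A = {x\<in>X. \<forall>y\<in>X. (x, y) \<in> R \<longrightarrow> y \<in> A}"

definition frame_dia :: "'x set \<Rightarrow> 'x rel \<Rightarrow> 'x rel \<Rightarrow> 'x set \<Rightarrow> 'x set" where
  "frame_dia X T Q A =
     {x\<in>X. \<forall>x'\<in>X. (x', x) \<in> T \<longrightarrow>
        (\<exists>y'\<in>X. (x', y') \<in> Q \<and> (\<exists>y\<in>X. (y', y) \<in> T \<and> y \<in> A))}"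

text \<open>Isomorphism from a complete lattice with three unary operations onto the
  fixpoint lattice of a frame with its three operations.\<close>

definition fixpoint_iso ::
  "('a::complete_lattice \<Rightarrow> 'a) \<Rightarrow> ('a \<Rightarrow> 'a) \<Rightarrow> ('a \<Rightarrow> 'a) \<Rightarrow>
   'x set \<Rightarrow> 'x rel \<Rightarrow> 'x rel \<Rightarrow> 'x rel \<Rightarrow> ('a \<Rightarrow> 'x set) \<Rightarrow> bool" where
  "fixpoint_iso neg box dia X T R Q f \<longleftrightarrow>
     bij_betw f UNIV (fixpoints X T) \<and>
     (\<forall>a b. a \<le> b \<longleftrightarrow> f a \<subseteq> f b) \<and>
     (\<forall>S. f (Inf S) = fix_Meet X (f ` S)) \<and>
     (\<forall>S. f (Sup S) = fix_Join X T (f ` S)) \<and>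
     (\<forall>a. f (neg a) = frame_neg X T (f a)) \<and>
     (\<forall>a. f (box a) = frame_box X R (f a)) \<and>
     (\<forall>a. f (dia a) = frame_dia X T Q (f a))"


section \<open>The frame of pairs\<close>

definition pair_carrier :: "('a::complete_lattice \<Rightarrow> 'a) \<Rightarrow> ('a \<times> 'a) set" where
  "pair_carrier neg = {(a, b). neg a \<le> b}"

definition pair_tri :: "('a::complete_lattice \<Rightarrow> 'a) \<Rightarrow> ('a \<times> 'a) rel" where
  "pair_tri neg =
     {(x, y). x \<in> pair_carrier neg \<and> y \<in> pair_carrier neg \<and> \<not> fst y \<le> snd x}"

definition pair_acc ::
  "('a::complete_lattice \<Rightarrow> 'a) \<Rightarrow> ('a \<Rightarrow> 'a) \<Rightarrow> ('a \<Rightarrow> 'a) \<Rightarrow> ('a \<times> 'a) rel" where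
  "pair_acc neg box dia =
     {(x, y). x \<in> pair_carrier neg \<and> y \<in> pair_carrier neg \<and>
        (\<forall>a. (fst x \<le> box a \<longrightarrow> fst y \<le> a) \<and> (dia a \<le> snd x \<longrightarrow> a \<le> snd y))}"

end

theory Submission
  imports Defs
begin

text \<open>As \<open>box\<close> has a left adjoint \<open>l\<close> and \<open>dia\<close> a right adjoint \<open>r\<close>, the accessibility relation
  reads \<open>fst y \<le> l (fst x) \<and> r (snd x) \<le> snd y\<close>. The inequality \<open>dia (neg a) \<le> neg (box a)\<close> puts
  the pair \<open>(l (fst x), r (snd x))\<close> into the carrier, so it is the best successor of \<open>x\<close>, and
  each frame condition becomes an inequality in the lattice. The closure of a set \<open>A\<close> of pairs
  is the set of pairs whose first component lies below the join of the first components in \<open>A\<close>;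
  hence \<open>a\<close> corresponds to the fixpoint of all pairs with first component below \<open>a\<close>.\<close>

section \<open>Adjoints of \<open>box\<close> and \<open>dia\<close>\<close>

lemma box_adjoint:
  fixes box :: "'a::complete_lattice \<Rightarrow> 'a"
  assumes "completely_multiplicative box"
  shows "Inf {a. x \<le> box a} \<le> c \<longleftrightarrow> x \<le> box c"
proof
  have box_Inf: "box (Inf S) = (INF a\<in>S. box a)" for S
    using assms by (simp add: completely_multiplicative_def)
  have unit: "x \<le> box (Inf {a. x \<le> box a})"
    by (auto simp: box_Inf intro: INF_greatest)
  assume "Inf {a. x \<le> box a} \<le> c"
  \<comment> \<open>Monotonicity of \<open>box\<close> is obtained from its preserving this binary
    meet.\<close>
  then have "inf (Inf {a. x \<le> box a}) c = Inf {a. x \<le> box a}"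
    by (rule inf_absorb1)
  then have "box (Inf {a. x \<le> box a}) \<le> box c"
    using box_Inf[of "{Inf {a. x \<le> box a}, c}"] by (simp add: le_iff_inf)
  with unit show "x \<le> box c"
    by (rule order_trans)
qed (simp add: Inf_lower)

lemma dia_adjoint:
  fixes dia :: "'a::complete_lattice \<Rightarrow> 'a"
  assumes "completely_additive dia"
  shows "c \<le> Sup {a. dia a \<le> x} \<longleftrightarrow> dia c \<le> x"
proof
  have dia_Sup: "dia (Sup S) = (SUP a\<in>S. dia a)" for S
    using assms by (simp add: completely_additive_def)
  have counit: "dia (Sup {a. dia a \<le> x}) \<le> x"
    by (auto simp: dia_Sup intro: SUP_least)
  assume "c \<le> Sup {a. dia a \<le> x}"
  then have "sup c (Sup {a. dia a \<le> x}) = Sup {a. dia a \<le> x}"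
    by (rule sup_absorb2)
  then have "dia c \<le> dia (Sup {a. dia a \<le> x})"
    using dia_Sup[of "{c, Sup {a. dia a \<le> x}}"] by (simp add: le_iff_sup)
  then show "dia c \<le> x"
    using counit by (rule order_trans)
qed (simp add: Sup_upper)

lemma dually_self_adjoint_antimono:
  assumes "dually_self_adjoint neg" "a \<le> b"
  shows "neg b \<le> neg a"
  using assms unfolding dually_self_adjoint_def by (meson order_refl order_trans)

definition pairs_below :: "('a::complete_lattice \<Rightarrow> 'a) \<Rightarrow> 'a \<Rightarrow> ('a \<times> 'a) set" where
  "pairs_below neg a = {x \<in> pair_carrier neg. fst x \<le> a}"

section \<open>Carrier, relations and best successors\<close>

locale modal_lattice =
  fixes neg box dia :: "'a::complete_lattice \<Rightarrow> 'a"
  assumes self_adjoint: "dually_self_adjoint neg"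
    and neg_top: "neg top = bot"
    and multiplicative: "completely_multiplicative box"
    and additive: "completely_additive dia"
    and dia_neg_le: "dia (neg a) \<le> neg (box a)"
begin

abbreviation "X \<equiv> pair_carrier neg"
abbreviation "T \<equiv> pair_tri neg"
abbreviation "R \<equiv> pair_acc neg box dia"
abbreviation "F \<equiv> pairs_below neg"

lemma carrier_iff: "(a, b) \<in> X \<longleftrightarrow> neg a \<le> b"
  by (simp add: pair_carrier_def)

lemma neg_fst_le_snd: "x \<in> X \<Longrightarrow> neg (fst x) \<le> snd x"
  by (auto simp: pair_carrier_def)

lemma pair_in_carrier [simp]: "(top, b) \<in> X" "(a, top) \<in> X" "(a, neg a) \<in> X"
  by (simp_all add: carrier_iff neg_top)

lemma tri_iff: "x \<in> X \<Longrightarrow> y \<in> X \<Longrightarrow> (x, y) \<in> T \<longleftrightarrow> \<not> fst y \<le> snd x"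
  by (simp add: pair_tri_def)

lemma acc_fst: "(x, y) \<in> R \<Longrightarrow> fst x \<le> box c \<Longrightarrow> fst y \<le> c"
  by (simp add: pair_acc_def)

lemma acc_snd: "(x, y) \<in> R \<Longrightarrow> dia c \<le> snd x \<Longrightarrow> c \<le> snd y"
  by (simp add: pair_acc_def)

lemma best_successor:
  assumes "x \<in> X"
  obtains y where "y \<in> X" "(x, y) \<in> R"
    "\<And>c. fst y \<le> c \<longleftrightarrow> fst x \<le> box c" "\<And>c. c \<le> snd y \<longleftrightarrow> dia c \<le> snd x"
proof
  define l where "l = Inf {a. fst x \<le> box a}"
  define r where "r = Sup {a. dia a \<le> snd x}"
  show l: "fst (l, r) \<le> c \<longleftrightarrow> fst x \<le> box c" for c
    using box_adjoint[OF multiplicative] by (simp add: l_def)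
  show r: "c \<le> snd (l, r) \<longleftrightarrow> dia c \<le> snd x" for c
    using dia_adjoint[OF additive] by (simp add: r_def)
  \<comment> \<open>By the adjunction for \<open>r\<close>, membership \<open>neg l \<le> r\<close>
    in the carrier amounts to \<open>dia (neg l) \<le> snd x\<close>.\<close>
  have "dia (neg l) \<le> neg (box l)"
    by (rule dia_neg_le)
  also have "\<dots> \<le> neg (fst x)"
    using l[of l] by (intro dually_self_adjoint_antimono[OF self_adjoint]) simp
  also have "\<dots> \<le> snd x"
    using assms by (rule neg_fst_le_snd)
  finally show lr: "(l, r) \<in> X"
    using r by (simp add: carrier_iff)
  show "(x, (l, r)) \<in> R"
    using assms lr l r by (simp add: pair_acc_def)
qed

text \<open>Raising the first component or lowering the second only makes a pair related to more
  points, so if any successor has the required relation to \<open>z\<close>, the best one has it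
  too. The adjunctions then eliminate the successor.\<close>

lemma acc_tri_iff:
  assumes "x \<in> X" "z \<in> X"
  shows "(\<exists>y\<in>X. (x, y) \<in> R \<and> (z, y) \<in> T) \<longleftrightarrow> \<not> fst x \<le> box (snd z)"
    and "(\<exists>y\<in>X. (x, y) \<in> R \<and> (y, z) \<in> T) \<longleftrightarrow> \<not> dia (fst z) \<le> snd x"
proof -
  obtain y where y: "y \<in> X" "(x, y) \<in> R"
      "\<And>c. fst y \<le> c \<longleftrightarrow> fst x \<le> box c" "\<And>c. c \<le> snd y \<longleftrightarrow> dia c \<le> snd x"
    using assms(1) by (rule best_successor) blast
  show "(\<exists>y\<in>X. (x, y) \<in> R \<and> (z, y) \<in> T) \<longleftrightarrow> \<not> fst x \<le> box (snd z)"
    using y(1-3) by (auto simp: tri_iff assms dest: acc_fst)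
  show "(\<exists>y\<in>X. (x, y) \<in> R \<and> (y, z) \<in> T) \<longleftrightarrow> \<not> dia (fst z) \<le> snd x"
    using y(1,2,4) by (auto simp: tri_iff assms dest: acc_snd)
qed

section \<open>Frame conditions\<close>

lemma modal_frame: "modal_frame X T R R"
  unfolding modal_frame_def
proof (intro conjI ballI impI)
  show "X \<noteq> {}"
    using pair_in_carrier(1) by blast
  show "T \<subseteq> X \<times> X" "R \<subseteq> X \<times> X" "R \<subseteq> X \<times> X"
    by (auto simp: pair_tri_def pair_acc_def)
  fix x y z
  assume X: "x \<in> X" "y \<in> X" "z \<in> X" and "(x, y) \<in> R \<and> (z, y) \<in> T"
  then have "\<not> fst x \<le> box (snd z)"
    using acc_fst tri_iff by blast
  \<comment> \<open>The witness is chosen so that being to its right is exactly the criterion of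
    \<open>acc_tri_iff(1)\<close>; first component \<open>top\<close> allows any second
    component.\<close>
  then have "((top, box (snd z)), x) \<in> T"
    using X by (simp add: tri_iff)
  moreover have "\<exists>y''\<in>X. (x'', y'') \<in> R \<and> (z, y'') \<in> T"
    if "x'' \<in> X" "((top, box (snd z)), x'') \<in> T" for x''
    using that X by (simp add: acc_tri_iff) (simp add: tri_iff)
  ultimately show "\<exists>x'\<in>X. (x', x) \<in> T \<and>
      (\<forall>x''\<in>X. (x', x'') \<in> T \<longrightarrow> (\<exists>y''\<in>X. (x'', y'') \<in> R \<and> (z, y'') \<in> T))"
    using pair_in_carrier(1) by blast
qed

lemma additive_frame: "additive_frame X T R R"
  unfolding additive_frame_def
proof (intro ballI impI)
  fix x y z
  assume X: "x \<in> X" "y \<in> X" "z \<in> X" and "(x, y) \<in> R \<and> (y, z) \<in> T"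
  then have "\<not> dia (fst z) \<le> snd x"
    using acc_snd tri_iff by blast
  \<comment> \<open>Dual choice: being to the left of this pair is the criterion of
    \<open>acc_tri_iff(2)\<close>.\<close>
  then have "(x, (dia (fst z), top)) \<in> T"
    using X by (simp add: tri_iff)
  moreover have "\<exists>y''\<in>X. (x'', y'') \<in> R \<and> (y'', z) \<in> T"
    if "x'' \<in> X" "(x'', (dia (fst z), top)) \<in> T" for x''
    using that X by (simp add: acc_tri_iff) (simp add: tri_iff)
  ultimately show "\<exists>x'\<in>X. (x, x') \<in> T \<and>
      (\<forall>x''\<in>X. (x'', x') \<in> T \<longrightarrow> (\<exists>y''\<in>X. (x'', y'') \<in> R \<and> (y'', z) \<in> T))"
    using pair_in_carrier(2) by blast
qed

text \<open>What lies to the left of a pair depends only on its first component. The second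
  component \<open>neg (fst x)\<close> is the least one allowed, so the pair itself lies to the left
  of as many points as possible.\<close>

lemma pre_refines_neg_pair: "x \<in> X \<Longrightarrow> pre_refines X T (fst x, neg (fst x)) x"
  by (simp add: pre_refines_def tri_iff)

lemma pseudo_symmetric: "pseudo_symmetric X T"
  unfolding pseudo_symmetric_def
proof (intro ballI impI)
  fix x y
  assume X: "x \<in> X" "y \<in> X" and "(y, x) \<in> T"
  then have "\<not> fst x \<le> neg (fst y)"
    using neg_fst_le_snd[of y] by (auto simp: tri_iff intro: order_trans)
  \<comment> \<open>Self-adjointness swaps the roles of \<open>fst x\<close> and
    \<open>fst y\<close>.\<close>
  then have "((fst x, neg (fst x)), y) \<in> T"
    using X self_adjoint by (auto simp: tri_iff dually_self_adjoint_def)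
  then show "\<exists>z\<in>X. (z, y) \<in> T \<and> pre_refines X T z x"
    using pre_refines_neg_pair X pair_in_carrier(3) by blast
qed

lemma pseudo_reflexive:
  assumes "\<And>a. inf a (neg a) = bot"
  shows "pseudo_reflexive X T"
  unfolding pseudo_reflexive_def
proof (intro ballI impI)
  fix x
  assume X: "x \<in> X" and "non_absurd X T x"
  then have "fst x \<noteq> bot"
    by (auto simp: non_absurd_def tri_iff)
  \<comment> \<open>Otherwise \<open>fst x \<le> neg (fst x)\<close>, and the meet of the two would
    be \<open>fst x\<close> rather than \<open>bot\<close>.\<close>
  then have "((fst x, neg (fst x)), x) \<in> T"
    using X assms[of "fst x"] by (auto simp: tri_iff inf_absorb1)
  then show "\<exists>z\<in>X. (z, x) \<in> T \<and> pre_refines X T z x"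
    using pre_refines_neg_pair X pair_in_carrier(3) by blast
qed

lemma negative_frame:
  assumes "\<And>a. neg (dia a) \<le> box (neg a)"
  shows "negative_frame X T R R"
  unfolding negative_frame_def
proof (intro ballI impI)
  fix x y z
  assume X: "x \<in> X" "y \<in> X" "z \<in> X" and xyz: "(x, y) \<in> R \<and> (z, y) \<in> T"
  have "\<not> fst x \<le> neg (dia (fst z))"
  proof
    assume "fst x \<le> neg (dia (fst z))"
    then have "fst x \<le> box (neg (fst z))"
      using assms by (rule order_trans)
    then have "fst y \<le> neg (fst z)"
      using xyz acc_fst by blast
    then show False
      using X xyz neg_fst_le_snd[of z] by (auto simp: tri_iff)
  qed
  \<comment> \<open>The first component encodes the criterion of \<open>acc_tri_iff(2)\<close> for
    points to the left of the witness; the second is the least possible, to place the witness to the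
    left of \<open>x\<close>.\<close>
  then have "((dia (fst z), neg (dia (fst z))), x) \<in> T"
    using X by (simp add: tri_iff)
  moreover have "\<exists>y''\<in>X. (x'', y'') \<in> R \<and> (y'', z) \<in> T"
    if "x'' \<in> X" "(x'', (dia (fst z), neg (dia (fst z)))) \<in> T" for x''
    using that X by (simp add: acc_tri_iff) (simp add: tri_iff)
  ultimately show "\<exists>x'\<in>X. (x', x) \<in> T \<and>
      (\<forall>x''\<in>X. (x'', x') \<in> T \<longrightarrow> (\<exists>y''\<in>X. (x'', y'') \<in> R \<and> (y'', z) \<in> T))"
    using pair_in_carrier(3) by blast
qed

section \<open>The isomorphism of complete lattices\<close>

text \<open>Testing against \<open>(top, s)\<close>, which lies to the left of exactly the pairs outside \<open>F s\<close>,
  detects membership in \<open>F s\<close>.\<close>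

lemma pairs_below_eq: "F s = {x \<in> X. \<forall>y\<in>X. (y, x) \<in> T \<longrightarrow> \<not> s \<le> snd y}"
proof (intro set_eqI iffI)
  fix x
  assume "x \<in> F s"
  then show "x \<in> {x \<in> X. \<forall>y\<in>X. (y, x) \<in> T \<longrightarrow> \<not> s \<le> snd y}"
    by (auto simp: pairs_below_def tri_iff dest: order_trans)
next
  fix x
  assume x: "x \<in> {x \<in> X. \<forall>y\<in>X. (y, x) \<in> T \<longrightarrow> \<not> s \<le> snd y}"
  then have "((top, s), x) \<notin> T"
    using pair_in_carrier(1) by fastforce
  then show "x \<in> F s"
    using x by (simp add: pairs_below_def tri_iff)
qed

text \<open>No point of \<open>A\<close> is to the right of \<open>y\<close> iff
  \<open>snd y\<close> bounds all first components in \<open>A\<close>, that is, bounds their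
  join.\<close>

lemma frame_closure_eq:
  assumes "A \<subseteq> X"
  shows "frame_closure X T A = F (Sup (fst ` A))"
proof -
  have "(\<exists>z\<in>X. (y, z) \<in> T \<and> z \<in> A) \<longleftrightarrow> \<not> Sup (fst ` A) \<le> snd y" if "y \<in> X" for y
    using assms that by (auto simp: tri_iff SUP_le_iff)
  then show ?thesis
    by (simp add: frame_closure_def pairs_below_eq cong: ball_cong conj_cong)
qed

lemma pairs_below_subset: "F a \<subseteq> X"
  by (auto simp: pairs_below_def)

text \<open>This left inverse of \<open>F\<close> yields injectivity and order reflection.\<close>

lemma Sup_fst_pairs_below: "Sup (fst ` F a) = a"
proof (rule antisym)
  show "Sup (fst ` F a) \<le> a"
    by (auto simp: pairs_below_def intro: SUP_least)
  show "a \<le> Sup (fst ` F a)"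
    by (rule Sup_upper) (force simp: pairs_below_def intro: image_eqI[where x = "(a, top)"])
qed

lemma pairs_below_le_iff: "F a \<subseteq> F b \<longleftrightarrow> a \<le> b"
proof
  assume "F a \<subseteq> F b"
  then have "Sup (fst ` F a) \<le> Sup (fst ` F b)"
    by (intro Sup_subset_mono image_mono)
  then show "a \<le> b"
    by (simp only: Sup_fst_pairs_below)
qed (auto simp: pairs_below_def)

lemma bij_betw_pairs_below: "bij_betw F UNIV (fixpoints X T)"
  unfolding bij_betw_def
proof
  show "inj F"
    using Sup_fst_pairs_below by (metis injI)
  show "range F = fixpoints X T"
  proof
    show "range F \<subseteq> fixpoints X T"
      using frame_closure_eq[OF pairs_below_subset] pairs_below_subset
      by (auto simp: fixpoints_def Sup_fst_pairs_below)
    show "fixpoints X T \<subseteq> range F"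
      using frame_closure_eq by (fastforce simp: fixpoints_def)
  qed
qed

lemma pairs_below_Inf: "F (Inf S) = fix_Meet X (F ` S)"
  by (auto simp: fix_Meet_def pairs_below_def le_Inf_iff)

lemma pairs_below_Sup: "F (Sup S) = fix_Join X T (F ` S)"
proof -
  have "fix_Join X T (F ` S) = F (Sup (fst ` \<Union> (F ` S)))"
    unfolding fix_Join_def using pairs_below_subset by (intro frame_closure_eq) blast
  also have "Sup (fst ` \<Union> (F ` S)) = (SUP a\<in>S. Sup (fst ` F a))"
    by (rule SUP_UNION)
  finally show ?thesis
    by (simp add: Sup_fst_pairs_below)
qed

section \<open>Compatibility with the operations\<close>

lemma pairs_below_neg: "F (neg a) = frame_neg X T (F a)"
proof (intro set_eqI iffI)
  fix x
  assume x: "x \<in> F (neg a)"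
  have "y \<notin> F a" if "y \<in> X" "(y, x) \<in> T" for y
  proof
    assume "y \<in> F a"
    then have "neg a \<le> neg (fst y)"
      using dually_self_adjoint_antimono[OF self_adjoint] by (simp add: pairs_below_def)
    also have "\<dots> \<le> snd y"
      using that(1) by (rule neg_fst_le_snd)
    finally show False
      using x that by (simp add: pairs_below_eq)
  qed
  then show "x \<in> frame_neg X T (F a)"
    using x pairs_below_subset by (auto simp: frame_neg_def)
next
  fix x
  assume x: "x \<in> frame_neg X T (F a)"
  \<comment> \<open>Among the pairs in \<open>F a\<close>, this one has the least second component,
    so it is the strongest test.\<close>
  then have "((a, neg a), x) \<notin> T"
    using pair_in_carrier(3) by (auto simp: frame_neg_def pairs_below_def)
  then show "x \<in> F (neg a)"
    using x by (simp add: frame_neg_def pairs_below_def tri_iff)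
qed

text \<open>A pair is outside \<open>F a\<close> exactly when \<open>(top, a)\<close> is to its
  left, so \<open>acc_tri_iff(1)\<close> decides whether some successor leaves
  \<open>F a\<close>.\<close>

lemma pairs_below_box: "F (box a) = frame_box X R (F a)"
proof -
  have "(\<forall>y\<in>X. (x, y) \<in> R \<longrightarrow> y \<in> F a) \<longleftrightarrow> fst x \<le> box a" if "x \<in> X" for x
    using acc_tri_iff(1)[OF that, of "(top, a)"] by (auto simp: tri_iff pairs_below_def)
  then show ?thesis
    by (auto simp: frame_box_def pairs_below_def)
qed

lemma pairs_below_dia: "F (dia a) = frame_dia X T R (F a)"
proof -
  \<comment> \<open>The pair \<open>(a, top)\<close> has the largest first component in
    \<open>F a\<close>, so it alone can replace the inner existential.\<close>
  have tri_F: "(\<exists>y\<in>X. (y', y) \<in> T \<and> y \<in> F a) \<longleftrightarrow> (y', (a, top)) \<in> T" if "y' \<in> X" for y'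
  proof
    assume "\<exists>y\<in>X. (y', y) \<in> T \<and> y \<in> F a"
    then show "(y', (a, top)) \<in> T"
      using that by (auto simp: tri_iff pairs_below_def dest: order_trans)
  next
    assume "(y', (a, top)) \<in> T"
    moreover have "(a, top) \<in> F a"
      by (simp add: pairs_below_def)
    ultimately show "\<exists>y\<in>X. (y', y) \<in> T \<and> y \<in> F a"
      using pair_in_carrier(2) by blast
  qed
  have "(\<exists>y'\<in>X. (x', y') \<in> R \<and> (\<exists>y\<in>X. (y', y) \<in> T \<and> y \<in> F a)) \<longleftrightarrow> \<not> dia a \<le> snd x'"
    if "x' \<in> X" for x'
    using acc_tri_iff(2)[OF that, of "(a, top)"] by (simp add: tri_F cong: bex_cong)
  then show ?thesis
    by (simp add: frame_dia_def pairs_below_eq[of "dia a"] cong: ball_cong conj_cong)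
qed

lemma fixpoint_iso_pairs_below: "fixpoint_iso neg box dia X T R R F"
  unfolding fixpoint_iso_def
  using bij_betw_pairs_below pairs_below_le_iff pairs_below_Inf pairs_below_Sup
    pairs_below_neg pairs_below_box pairs_below_dia
  by blast

end

theorem theorem5p2:
  fixes neg box dia :: "'a::complete_lattice \<Rightarrow> 'a"
    and X :: "('a \<times> 'a) set" and T R Q :: "('a \<times> 'a) rel"
  assumes "dually_self_adjoint neg"
    and "neg top = bot"
    and "completely_multiplicative box"
    and "completely_additive dia"
    and "\<And>a. dia (neg a) \<le> neg (box a)"
    and "X = pair_carrier neg"
    and "T = pair_tri neg"
    and "R = pair_acc neg box dia"
    and "Q = R"
  shows "(modal_frame X T R Q \<and> unified_frame X T R Q \<and> additive_frame X T R Q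
            \<and> pseudo_symmetric X T)
       \<and> (\<exists>f. fixpoint_iso neg box dia X T R Q f)
       \<and> ((\<forall>a. inf a (neg a) = bot) \<longrightarrow> pseudo_reflexive X T)
       \<and> ((\<forall>a. neg (dia a) \<le> box (neg a)) \<longrightarrow> negative_frame X T R Q)"
proof -
  interpret modal_lattice neg box dia
    using assms by unfold_locales
  show ?thesis
    using modal_frame additive_frame pseudo_symmetric fixpoint_iso_pairs_below
      pseudo_reflexive negative_frame
    unfolding assms unified_frame_def by blast
qed

end
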